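(* Let $d\ge1$ and let $\widetilde{\mathbb H}^d=\mathbb N^d\times\mathbb N^d\times(\mathbb R\setminus\{0\})$ be endowed with the distance $$\widehat d\big((n,m,\lambda),(n',m',\lambda')\big)=|\lambda(n+m)-\lambda'(n'+m')|_1+|(n-m)-(n'-m')|_1+|\lambda-\lambda'|.$$ The completion of $\widetilde{\mathbb H}^d$ for the distance $\widehat d$ is the (disjoint union) set $$\widehat{\mathbb H}^d=\big(\mathbb N^{2d}\times(\mathbb R\setminus\{0\})\big)\cup\widehat{\mathbb H}^d_0,\qquad \widehat{\mathbb H}^d_0=\big((\mathbb R_-)^d\cup(\mathbb R_+)^d\big)\times\mathbb Z^d,$$ and on $\widehat{\mathbb H}^d$ the extended distance (still denoted $\widehat d$) is given by $$\widehat d\big((n,m,\lambda),(n',m',\lambda')\big)=|\lambda(n+m)-\lambda'(n'+m')|_1+|(m-n)-(m'-n')|_1+|\lambda-\lambda'|\quad\text{if }\lambda\ne0,\ \lambda'\neq0,$$ $$\widehat d\big((n,m,\lambda),(\dot x,k)\big)=\widehat d\big((\dot x,k),(n,m,\lambda)\big)=|\lambda(n+m)-\dot x|_1+|m-n-k|_1+|\lambda|\quad\text{if }\lambda\ne0,$$ $$\widehat d\big((\dot x,k),(\dot x',k')\big)=|\dot x-\dot x'|_1+|k-k'|_1.$$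
   Context: $\mathbb N$ includes $0$; $|\cdot|_1$ is the $\ell^1$ norm on $\mathbb R^d$; $\mathbb R_+=[0,\infty)$ and $\mathbb R_-=(-\infty,0]$. "Completion" means: $(\widehat{\mathbb H}^d,\widehat d)$ is a complete metric space containing $(\widetilde{\mathbb H}^d,\widehat d)$ isometrically as a dense subset. *)

theory Defs
  imports "HOL-Analysis.Analysis"
begin

definition norm_l1 :: "real ^ 'd \<Rightarrow> real" where
  "norm_l1 x = (\<Sum>i\<in>UNIV. \<bar>x $ i\<bar>)"

definition rvec_of_nat :: "nat ^ 'd \<Rightarrow> real ^ 'd" where
  "rvec_of_nat n = (\<chi> i. real (n $ i))"

definition rvec_of_int :: "int ^ 'd \<Rightarrow> real ^ 'd" where
  "rvec_of_int k = (\<chi> i. real_of_int (k $ i))"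

text \<open>The dimension \<open>d \<ge> 1\<close> is the cardinality of the (necessarily nonempty) finite index
  type \<open>'d\<close>. Vectors of naturals are mapped into \<open>real ^ 'd\<close> before subtracting, since
  subtraction on \<open>nat\<close> truncates.\<close>

definition H_tilde :: "((nat ^ 'd) \<times> (nat ^ 'd) \<times> real) set" where
  "H_tilde = UNIV \<times> UNIV \<times> (UNIV - {0})"

fun dist_tilde :: "(nat ^ 'd) \<times> (nat ^ 'd) \<times> real \<Rightarrow> (nat ^ 'd) \<times> (nat ^ 'd) \<times> real \<Rightarrow> real" where
  "dist_tilde (n, m, l) (n', m', l') =
     norm_l1 (l *\<^sub>R (rvec_of_nat n + rvec_of_nat m) - l' *\<^sub>R (rvec_of_nat n' + rvec_of_nat m'))
     + norm_l1 ((rvec_of_nat n - rvec_of_nat m) - (rvec_of_nat n' - rvec_of_nat m'))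
     + \<bar>l - l'\<bar>"

definition H_hat0 :: "((real ^ 'd) \<times> (int ^ 'd)) set" where
  "H_hat0 = ({x. \<forall>i. x $ i \<le> 0} \<union> {x. \<forall>i. x $ i \<ge> 0}) \<times> UNIV"

text \<open>\<open>A <+> B\<close> is the disjoint union \<open>Inl ` A \<union> Inr ` B\<close>.\<close>

definition H_hat :: "((nat ^ 'd) \<times> (nat ^ 'd) \<times> real + (real ^ 'd) \<times> (int ^ 'd)) set" where
  "H_hat = H_tilde <+> H_hat0"

fun dist_hat :: "(nat ^ 'd) \<times> (nat ^ 'd) \<times> real + (real ^ 'd) \<times> (int ^ 'd)
    \<Rightarrow> (nat ^ 'd) \<times> (nat ^ 'd) \<times> real + (real ^ 'd) \<times> (int ^ 'd) \<Rightarrow> real" where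
  "dist_hat (Inl (n, m, l)) (Inl (n', m', l')) =
     norm_l1 (l *\<^sub>R (rvec_of_nat n + rvec_of_nat m) - l' *\<^sub>R (rvec_of_nat n' + rvec_of_nat m'))
     + norm_l1 ((rvec_of_nat m - rvec_of_nat n) - (rvec_of_nat m' - rvec_of_nat n'))
     + \<bar>l - l'\<bar>"
| "dist_hat (Inl (n, m, l)) (Inr (x, k)) =
     norm_l1 (l *\<^sub>R (rvec_of_nat n + rvec_of_nat m) - x)
     + norm_l1 (rvec_of_nat m - rvec_of_nat n - rvec_of_int k) + \<bar>l\<bar>"
| "dist_hat (Inr (x, k)) (Inl (n, m, l)) =
     norm_l1 (l *\<^sub>R (rvec_of_nat n + rvec_of_nat m) - x)
     + norm_l1 (rvec_of_nat m - rvec_of_nat n - rvec_of_int k) + \<bar>l\<bar>"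
| "dist_hat (Inr (x, k)) (Inr (x', k')) =
     norm_l1 (x - x') + norm_l1 (rvec_of_int k - rvec_of_int k')"

text \<open>\<open>(M', d')\<close> is a completion of the metric space \<open>(M, d)\<close>, where \<open>\<iota>\<close> is the inclusion of
  \<open>M\<close> into \<open>M'\<close>.\<close>

definition is_completion ::
    "'a set \<Rightarrow> ('a \<Rightarrow> 'a \<Rightarrow> real) \<Rightarrow> ('a \<Rightarrow> 'b) \<Rightarrow> 'b set \<Rightarrow> ('b \<Rightarrow> 'b \<Rightarrow> real) \<Rightarrow> bool" where
  "is_completion M d \<iota> M' d' \<longleftrightarrow>
     Metric_space M d \<and> Metric_space M' d' \<and> Metric_space.mcomplete M' d'
     \<and> \<iota> ` M \<subseteq> M' \<and> (\<forall>p\<in>M. \<forall>q\<in>M. d' (\<iota> p) (\<iota> q) = d p q)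
     \<and> Metric_space.mtopology M' d' closure_of (\<iota> ` M) = M'"

end

theory Submission
  imports Defs
begin

text \<open>Everything happens inside the finite-dimensional space of triples \<open>(y, z, l)\<close>, with
  \<open>y\<close> and \<open>z\<close> in \<open>\<real>\<^sup>d\<close> and \<open>l\<close> real. The map \<open>embed\<close> sends \<open>(n, m, \<lambda>)\<close> to
  \<open>(\<lambda>(n + m), m - n, \<lambda>)\<close> and a boundary point \<open>(x, k)\<close> to \<open>(x, k, 0)\<close>. Both distances are
  the pullback of the \<open>\<ell>\<^sup>1\<close> distance along this map (\<open>dist_hat_embed\<close>, \<open>dist_tilde_embed\<close>), and
  the map is injective on \<open>H_hat\<close> (\<open>inj_on_embed\<close>), so both are metrics and \<open>dist_hat\<close> restricts
  to \<open>dist_tilde\<close>. What remains is that the image of \<open>H_hat\<close> is closed, hence complete, and that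
  every boundary point is a limit of points with \<open>\<lambda> \<noteq> 0\<close>.

  For closedness, the parameters are recovered from a triple with \<open>l \<noteq> 0\<close> by
  \<open>n = (y / l - z) / 2\<close> and \<open>m = (y / l + z) / 2\<close>. The image therefore consists of the triples
  for which \<open>z\<close> is integral, the coordinates of \<open>y\<close> share a sign, and these quotients are
  natural numbers whenever \<open>l \<noteq> 0\<close> (\<open>embed_image\<close>). Each condition survives limits, because
  \<open>\<nat>\<close> and \<open>\<int>\<close> are closed in \<open>\<real>\<close> and the quotients are continuous away from \<open>l = 0\<close>
  (\<open>closed_embed_image\<close>); at \<open>l = 0\<close> the last condition disappears. This is also why the boundary
  contains the two closed orthants only: \<open>n + m\<close> has nonnegative coordinates, so
  \<open>\<lambda>(n + m)\<close> has coordinates of a single sign, and so have its limits.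

  For density (\<open>H_tilde_approximates_H_hat0\<close>), the values \<open>\<lambda>(n + m)\<close> with \<open>m - n = k\<close> fixed
  form a grid of mesh \<open>2\<bar>\<lambda>\<bar>\<close> starting at \<open>\<lambda>\<bar>k\<bar>\<close>, so they fill the half-line with the sign
  of \<open>\<lambda>\<close> as \<open>\<lambda> \<rightarrow> 0\<close>.\<close>

section \<open>The two distances as pullbacks of an l1 distance\<close>

lemma norm_l1_nonneg: "0 \<le> norm_l1 x"
  by (simp add: norm_l1_def sum_nonneg)

lemma norm_l1_minus_commute: "norm_l1 (x - y) = norm_l1 (y - x)"
  by (simp add: norm_l1_def abs_minus_commute)

lemma norm_l1_triangle: "norm_l1 (x + y) \<le> norm_l1 x + norm_l1 y"
  by (simp add: norm_l1_def flip: sum.distrib) (intro sum_mono abs_triangle_ineq)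

lemma norm_le_norm_l1: "norm x \<le> norm_l1 x"
  by (simp add: norm_l1_def norm_le_l1_cart)

lemma tendsto_norm_l1_0:
  assumes "(f \<longlongrightarrow> 0) F"
  shows "((\<lambda>j. norm_l1 (f j)) \<longlongrightarrow> 0) F"
proof -
  have "((\<lambda>j. \<Sum>i\<in>UNIV. \<bar>f j $ i\<bar>) \<longlongrightarrow> (\<Sum>i\<in>UNIV. \<bar>(0 :: real ^ 'b) $ i\<bar>)) F"
    by (intro tendsto_intros assms)
  then show ?thesis
    by (simp add: norm_l1_def)
qed

definition l1_triple :: "(real ^ 'd) \<times> (real ^ 'd) \<times> real \<Rightarrow> real" where
  "l1_triple v = norm_l1 (fst v) + norm_l1 (fst (snd v)) + \<bar>snd (snd v)\<bar>"

lemma l1_triple_nonneg: "0 \<le> l1_triple v"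
  by (simp add: l1_triple_def norm_l1_nonneg)

lemma l1_triple_minus_commute: "l1_triple (v - w) = l1_triple (w - v)"
  by (simp add: l1_triple_def norm_l1_minus_commute abs_minus_commute)

lemma l1_triple_triangle: "l1_triple (u - w) \<le> l1_triple (u - v) + l1_triple (v - w)"
  using norm_l1_triangle[of "fst u - fst v" "fst v - fst w"]
    norm_l1_triangle[of "fst (snd u) - fst (snd v)" "fst (snd v) - fst (snd w)"]
  by (simp add: l1_triple_def)

lemma norm_le_l1_triple: "norm v \<le> l1_triple v"
proof -
  obtain y z l where v: "v = (y, z, l)"
    by (cases v)
  have "norm v \<le> norm y + (norm z + norm l)"
    unfolding v by (intro order_trans[OF norm_Pair_le] add_left_mono norm_Pair_le)
  then show ?thesis
    using norm_le_norm_l1[of y] norm_le_norm_l1[of z] by (simp add: l1_triple_def v)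
qed

lemma l1_triple_eq_0_iff: "l1_triple v = 0 \<longleftrightarrow> v = 0"
  using norm_le_l1_triple[of v] by (auto simp: l1_triple_def norm_l1_def)

lemma tendsto_l1_triple_0:
  assumes "(f \<longlongrightarrow> v) F"
  shows "((\<lambda>j. l1_triple (f j - v)) \<longlongrightarrow> 0) F"
proof -
  have "((\<lambda>j. f j - v) \<longlongrightarrow> 0) F"
    using assms by (rule LIM_zero)
  note tendsto_fst[OF this] tendsto_snd[OF this]
  then have "((\<lambda>j. l1_triple (f j - v)) \<longlongrightarrow> 0 + 0 + \<bar>0\<bar>) F"
    unfolding l1_triple_def
    by (intro tendsto_add tendsto_norm_l1_0 tendsto_rabs) (auto dest: tendsto_fst tendsto_snd)
  then show ?thesis
    by simp
qed

fun embed :: "(nat ^ 'd) \<times> (nat ^ 'd) \<times> real + (real ^ 'd) \<times> (int ^ 'd)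
    \<Rightarrow> (real ^ 'd) \<times> (real ^ 'd) \<times> real" where
  "embed (Inl (n, m, l)) =
     (l *\<^sub>R (rvec_of_nat n + rvec_of_nat m), rvec_of_nat m - rvec_of_nat n, l)"
| "embed (Inr (x, k)) = (x, rvec_of_int k, 0)"

lemma dist_hat_embed: "dist_hat p q = l1_triple (embed p - embed q)"
  by (cases "(p, q)" rule: dist_hat.cases)
    (simp_all add: l1_triple_def norm_l1_minus_commute)

lemma dist_tilde_embed: "dist_tilde p q = l1_triple (embed (Inl p) - embed (Inl q))"
proof -
  obtain n m l n' m' l' where pq: "p = (n, m, l)" "q = (n', m', l')"
    by (metis prod_cases3)
  have neg: "(rvec_of_nat n - rvec_of_nat m) - (rvec_of_nat n' - rvec_of_nat m')
      = (rvec_of_nat m' - rvec_of_nat n') - (rvec_of_nat m - rvec_of_nat n)"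
    by simp
  have "norm_l1 ((rvec_of_nat n - rvec_of_nat m) - (rvec_of_nat n' - rvec_of_nat m'))
      = norm_l1 ((rvec_of_nat m - rvec_of_nat n) - (rvec_of_nat m' - rvec_of_nat n'))"
    unfolding neg by (rule norm_l1_minus_commute)
  then show ?thesis
    by (simp add: pq l1_triple_def)
qed

text \<open>When \<open>\<lambda> \<noteq> 0\<close>, both the sum and the difference of \<open>n\<close> and \<open>m\<close> can be read off the
  image; the last component tells the two parts of \<open>H_hat\<close> apart.\<close>

lemma inj_on_embed: "inj_on embed H_hat"
proof (rule inj_onI)
  fix p q :: "(nat ^ 'd) \<times> (nat ^ 'd) \<times> real + (real ^ 'd) \<times> (int ^ 'd)"
  assume mem: "p \<in> H_hat" "q \<in> H_hat" and eq: "embed p = embed q"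
  show "p = q"
  proof (cases "(p, q)" rule: dist_hat.cases)
    case (1 n m l n' m' l')
    with mem have "l \<noteq> 0"
      by (auto simp: H_hat_def H_tilde_def)
    with 1 eq have l: "l' = l"
      and sum: "rvec_of_nat n + rvec_of_nat m = rvec_of_nat n' + rvec_of_nat m'"
      and diff: "rvec_of_nat m - rvec_of_nat n = rvec_of_nat m' - rvec_of_nat n'"
      by auto
    have "n $ i = n' $ i \<and> m $ i = m' $ i" for i
      using arg_cong[OF sum, of "\<lambda>v. v $ i"] arg_cong[OF diff, of "\<lambda>v. v $ i"]
      by (simp add: rvec_of_nat_def)
    with 1 l show ?thesis
      by (simp add: vec_eq_iff)
  qed (use mem eq in \<open>auto simp: H_hat_def H_tilde_def rvec_of_int_def vec_eq_iff\<close>)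
qed

lemma Metric_space_H_hat: "Metric_space H_hat dist_hat"
proof
  fix p q r :: "(nat ^ 'd) \<times> (nat ^ 'd) \<times> real + (real ^ 'd) \<times> (int ^ 'd)"
  show "0 \<le> dist_hat p q" and "dist_hat p q = dist_hat q p"
    by (simp_all add: dist_hat_embed l1_triple_nonneg l1_triple_minus_commute)
  show "dist_hat p r \<le> dist_hat p q + dist_hat q r"
    by (simp add: dist_hat_embed l1_triple_triangle)
  assume "p \<in> H_hat" "q \<in> H_hat"
  then show "dist_hat p q = 0 \<longleftrightarrow> p = q"
    by (simp add: dist_hat_embed l1_triple_eq_0_iff inj_on_eq_iff[OF inj_on_embed])
qed

lemma Metric_space_H_tilde: "Metric_space H_tilde dist_tilde"
proof
  fix p q r :: "(nat ^ 'd) \<times> (nat ^ 'd) \<times> real"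
  show "0 \<le> dist_tilde p q" and "dist_tilde p q = dist_tilde q p"
    by (simp_all add: dist_tilde_embed l1_triple_nonneg l1_triple_minus_commute)
  show "dist_tilde p r \<le> dist_tilde p q + dist_tilde q r"
    by (simp add: dist_tilde_embed l1_triple_triangle)
  assume "p \<in> H_tilde" "q \<in> H_tilde"
  then have "Inl p \<in> H_hat" "Inl q \<in> H_hat"
    by (auto simp: H_hat_def)
  then show "dist_tilde p q = 0 \<longleftrightarrow> p = q"
    by (simp add: dist_tilde_embed l1_triple_eq_0_iff inj_on_eq_iff[OF inj_on_embed])
qed

section \<open>Completeness\<close>

text \<open>Given \<open>\<lambda>(n + m) = y\<close> and \<open>m - n = z\<close> with \<open>\<lambda> \<noteq> 0\<close>, solving for \<open>n\<close> and \<open>m\<close> turns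
  membership in the image into conditions that are visibly stable under limits.\<close>

lemma embed_image:
  "(y, z, l) \<in> embed ` H_hat \<longleftrightarrow>
     ((\<forall>i. y $ i \<le> 0) \<or> (\<forall>i. 0 \<le> y $ i)) \<and> (\<forall>i. z $ i \<in> \<int>)
     \<and> (l \<noteq> 0 \<longrightarrow> (\<forall>i. (y $ i / l - z $ i) / 2 \<in> \<nat> \<and> (y $ i / l + z $ i) / 2 \<in> \<nat>))"
    (is "?lhs \<longleftrightarrow> ?rhs")
proof
  assume ?lhs
  then obtain p where p: "p \<in> H_hat" "embed p = (y, z, l)"
    by force
  show ?rhs
  proof (cases p rule: embed.cases)
    case (1 n m l')
    with p have l: "l' = l" "l \<noteq> 0" and y: "\<And>i. y $ i = l * real (n $ i + m $ i)"
      and z: "\<And>i. z $ i = real (m $ i) - real (n $ i)"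
      by (auto simp: H_hat_def H_tilde_def rvec_of_nat_def)
    have n: "(y $ i / l - z $ i) / 2 = real (n $ i)"
      and m: "(y $ i / l + z $ i) / 2 = real (m $ i)" for i
      using l by (simp_all add: y z)
    have "(y $ i / l - z $ i) / 2 \<in> \<nat> \<and> (y $ i / l + z $ i) / 2 \<in> \<nat>" for i
      unfolding n m by simp
    moreover have "z $ i \<in> \<int>" for i
      by (simp add: z)
    moreover have "(\<forall>i. y $ i \<le> 0) \<or> (\<forall>i. 0 \<le> y $ i)"
      using l unfolding y by (cases "l > 0") (auto simp: mult_nonpos_nonneg)
    ultimately show ?thesis
      by blast
  next
    case (2 x k)
    with p show ?thesis
      by (auto simp: H_hat_def H_hat0_def rvec_of_int_def)
  qed
next
  assume r: ?rhs
  show ?lhs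
  proof (cases "l = 0")
    case True
    have "\<forall>i. \<exists>k. z $ i = of_int k"
      using r by (blast elim: Ints_cases)
    then obtain k where k: "\<And>i. z $ i = of_int (k i)"
      unfolding choice_iff by blast
    have "embed (Inr (y, \<chi> i. k i)) = (y, z, l)"
      by (simp add: True k rvec_of_int_def vec_eq_iff)
    moreover have "Inr (y, \<chi> i. k i) \<in> H_hat"
      using r by (auto simp: H_hat_def H_hat0_def)
    ultimately show ?thesis
      by (metis imageI)
  next
    case False
    with r have "\<forall>i. \<exists>n. (y $ i / l - z $ i) / 2 = real n"
      and "\<forall>i. \<exists>m. (y $ i / l + z $ i) / 2 = real m"
      by (blast elim: Nats_cases)+
    then obtain n m where n: "\<And>i. (y $ i / l - z $ i) / 2 = real (n i)"
      and m: "\<And>i. (y $ i / l + z $ i) / 2 = real (m i)"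
      unfolding choice_iff by blast
    have "y $ i = l * (real (n i) + real (m i)) \<and> z $ i = real (m i) - real (n i)" for i
      unfolding n[symmetric] m[symmetric] using False by (simp add: field_simps)
    then have "embed (Inl (\<chi> i. n i, \<chi> i. m i, l)) = (y, z, l)"
      by (simp add: rvec_of_nat_def vec_eq_iff)
    moreover have "Inl (\<chi> i. n i, \<chi> i. m i, l) \<in> H_hat"
      using False by (auto simp: H_hat_def H_tilde_def)
    ultimately show ?thesis
      by (metis imageI)
  qed
qed

lemma closed_Nats_real: "closed (\<nat> :: real set)"
  unfolding Nats_def by (rule closed_of_nat_image)

lemma closed_embed_image:
  "closed (embed ` (H_hat :: ((nat ^ 'd::finite) \<times> (nat ^ 'd) \<times> real
      + (real ^ 'd) \<times> (int ^ 'd)) set))"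
  unfolding closed_sequential_limits
proof (intro allI impI, elim conjE)
  fix v :: "nat \<Rightarrow> (real ^ 'd) \<times> (real ^ 'd) \<times> real" and w
  assume mem: "\<forall>j. v j \<in> embed ` H_hat" and lim: "v \<longlonglongrightarrow> w"
  obtain y z l where w: "w = (y, z, l)"
    by (cases w)
  define Y Z L where "Y = (\<lambda>j. fst (v j))" and "Z = (\<lambda>j. fst (snd (v j)))"
    and "L = (\<lambda>j. snd (snd (v j)))"
  have Y: "Y \<longlonglongrightarrow> y" and Z: "Z \<longlonglongrightarrow> z" and L: "L \<longlonglongrightarrow> l"
    using tendsto_fst[OF lim] tendsto_fst[OF tendsto_snd[OF lim]]
      tendsto_snd[OF tendsto_snd[OF lim]]
    by (simp_all add: Y_def Z_def L_def w)
  have "(Y j, Z j, L j) \<in> embed ` H_hat" for j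
    using mem by (simp add: Y_def Z_def L_def)
  then have sign: "Y j \<in> {u. \<forall>i. u $ i \<le> 0} \<union> {u. \<forall>i. 0 \<le> u $ i}"
    and int: "Z j $ i \<in> \<int>"
    and nat: "L j \<noteq> 0 \<Longrightarrow> (Y j $ i / L j - Z j $ i) / 2 \<in> \<nat>"
      "L j \<noteq> 0 \<Longrightarrow> (Y j $ i / L j + Z j $ i) / 2 \<in> \<nat>" for i j
    unfolding embed_image by auto
  have "closed ({u :: real ^ 'd. \<forall>i. u $ i \<le> 0} \<union> {u. \<forall>i. 0 \<le> u $ i})"
    by (intro closed_Un closed_Collect_all closed_Collect_le continuous_intros)
  from closed_sequentially[OF this sign Y]
  have "(\<forall>i. y $ i \<le> 0) \<or> (\<forall>i. 0 \<le> y $ i)"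
    by simp
  moreover have "z $ i \<in> \<int>" for i
    using closed_sequentially[OF closed_Ints int tendsto_vec_nth[OF Z]] by simp
  moreover have "(y $ i / l - z $ i) / 2 \<in> \<nat> \<and> (y $ i / l + z $ i) / 2 \<in> \<nat>" if "l \<noteq> 0" for i
  proof
    have ev: "\<forall>\<^sub>F j in sequentially. L j \<noteq> 0"
      using L that by (rule tendsto_imp_eventually_ne)
    have "(\<lambda>j. (Y j $ i / L j - Z j $ i) / 2) \<longlonglongrightarrow> (y $ i / l - z $ i) / 2"
      using that by (intro tendsto_intros Y Z L) auto
    then show "(y $ i / l - z $ i) / 2 \<in> \<nat>"
      by (intro Lim_in_closed_set[OF closed_Nats_real eventually_mono[OF ev nat(1)]]) auto
    have "(\<lambda>j. (Y j $ i / L j + Z j $ i) / 2) \<longlonglongrightarrow> (y $ i / l + z $ i) / 2"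
      using that by (intro tendsto_intros Y Z L) auto
    then show "(y $ i / l + z $ i) / 2 \<in> \<nat>"
      by (intro Lim_in_closed_set[OF closed_Nats_real eventually_mono[OF ev nat(2)]]) auto
  qed
  ultimately show "w \<in> embed ` H_hat"
    unfolding w embed_image by blast
qed

lemma mcomplete_H_hat:
  "Metric_space.mcomplete (H_hat :: ((nat ^ 'd::finite) \<times> (nat ^ 'd) \<times> real
      + (real ^ 'd) \<times> (int ^ 'd)) set) dist_hat"
proof -
  interpret Metric_space
    "H_hat :: ((nat ^ 'd) \<times> (nat ^ 'd) \<times> real + (real ^ 'd) \<times> (int ^ 'd)) set" dist_hat
    by (rule Metric_space_H_hat)
  show ?thesis
    unfolding mcomplete_def
  proof (intro allI impI)
    fix p :: "nat \<Rightarrow> (nat ^ 'd) \<times> (nat ^ 'd) \<times> real + (real ^ 'd) \<times> (int ^ 'd)"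
    assume p: "MCauchy p"
    then have mem: "p j \<in> H_hat" for j
      by (auto simp: MCauchy_def)
    have "Cauchy (\<lambda>j. embed (p j))"
      unfolding Cauchy_def
    proof (intro allI impI)
      fix e :: real
      assume "e > 0"
      with p obtain N where N: "\<And>i j. N \<le> i \<Longrightarrow> N \<le> j \<Longrightarrow> dist_hat (p i) (p j) < e"
        unfolding MCauchy_def by meson
      have "dist (embed (p i)) (embed (p j)) \<le> dist_hat (p i) (p j)" for i j
        by (simp add: dist_norm dist_hat_embed norm_le_l1_triple)
      with N show "\<exists>N. \<forall>i\<ge>N. \<forall>j\<ge>N. dist (embed (p i)) (embed (p j)) < e"
        by (meson le_less_trans)
    qed
    then obtain w where lim: "(\<lambda>j. embed (p j)) \<longlonglongrightarrow> w"
      using Cauchy_convergent convergent_def by blast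
    have "w \<in> embed ` H_hat"
      by (rule closed_sequentially[OF closed_embed_image imageI[OF mem] lim])
    then obtain q where q: "q \<in> H_hat" "w = embed q"
      by blast
    have "(\<lambda>j. dist_hat (p j) q) \<longlonglongrightarrow> 0"
      using tendsto_l1_triple_0[OF lim] by (simp add: dist_hat_embed q)
    with q mem show "\<exists>x. limitin mtopology p x sequentially"
      by (auto simp: limitin_metric_dist_null)
  qed
qed

section \<open>Density\<close>

text \<open>The pairs with \<open>m - n = k\<close> are \<open>n = a + max (-k) 0\<close>, \<open>m = a + max k 0\<close> with \<open>a\<close> a
  natural number, and then \<open>n + m = 2 * a + \<bar>k\<bar>\<close>. Taking for \<open>a\<close> the integer part of
  \<open>x / (2 * l)\<close> brings \<open>l * (n + m)\<close> within \<open>\<bar>l\<bar> * (2 + \<bar>k\<bar>)\<close> of \<open>x\<close>.\<close>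

lemma nat_pair_approximation:
  fixes l x :: real and k :: int
  assumes "l \<noteq> 0" and "0 \<le> x / l"
  shows "\<exists>n m :: nat. real m - real n = of_int k
    \<and> \<bar>l * (real n + real m) - x\<bar> \<le> \<bar>l\<bar> * (2 + \<bar>of_int k\<bar>)"
proof -
  define t where "t = x / l"
  define a where "a = nat \<lfloor>t / 2\<rfloor>"
  have "real a = of_int \<lfloor>t / 2\<rfloor>"
    using assms(2) by (simp add: a_def t_def)
  then have a: "real a \<le> t / 2" "t / 2 < real a + 1"
    by (simp_all only: of_int_floor_le real_of_int_floor_add_one_gt)
  define n m where "n = a + nat (- k)" and "m = a + nat k"
  have diff: "real m - real n = of_int k"
    and sum: "real n + real m = 2 * real a + \<bar>of_int k\<bar>"
    unfolding n_def m_def by (cases "0 \<le> k"; simp)+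
  have eq: "\<bar>l * (real n + real m) - x\<bar> = \<bar>l\<bar> * \<bar>(real n + real m) - t\<bar>"
    using assms(1) by (simp add: t_def right_diff_distrib flip: abs_mult)
  have "\<bar>(real n + real m) - t\<bar> \<le> 2 + \<bar>of_int k\<bar>"
    unfolding sum using a by linarith
  then have "\<bar>l\<bar> * \<bar>(real n + real m) - t\<bar> \<le> \<bar>l\<bar> * (2 + \<bar>of_int k\<bar>)"
    by (rule mult_left_mono) simp
  with diff show ?thesis
    unfolding eq[symmetric] by blast
qed

text \<open>The sign of \<open>\<lambda>\<close> has to match the orthant that contains \<open>x\<close>, so reaching
  both orthants takes both signs.\<close>

lemma H_tilde_approximates_H_hat0:
  fixes x :: "real ^ 'd::finite" and k :: "int ^ 'd"
  assumes "(x, k) \<in> H_hat0" and "0 < e"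
  shows "\<exists>p\<in>H_tilde. dist_hat (Inr (x, k)) (Inl p) < e"
proof -
  \<comment> \<open>The total error is at most \<open>\<bar>l\<bar>\<close> times this constant: the \<open>1\<close> accounts for the
    distance from \<open>l\<close> to \<open>0\<close>, the sum for the coordinates.\<close>
  define C where "C = 1 + (\<Sum>i\<in>UNIV. 2 + \<bar>real_of_int (k $ i)\<bar>)"
  have C: "0 < C"
    unfolding C_def by (intro add_pos_nonneg sum_nonneg) auto
  define \<delta> where "\<delta> = e / (2 * C)"
  have \<delta>: "0 < \<delta>" "\<delta> * C < e"
    using C assms(2) by (simp_all add: \<delta>_def)
  define l where "l = (if \<forall>i. 0 \<le> x $ i then \<delta> else - \<delta>)"
  have l: "l \<noteq> 0" "\<bar>l\<bar> = \<delta>"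
    using \<delta>(1) by (auto simp: l_def)
  have "0 \<le> x $ i / l" for i
    using assms(1) \<delta>(1) by (auto simp: l_def H_hat0_def divide_nonpos_pos)
  from nat_pair_approximation[OF l(1) this]
  have "\<forall>i. \<exists>n m. real m - real n = real_of_int (k $ i)
      \<and> \<bar>l * (real n + real m) - x $ i\<bar> \<le> \<bar>l\<bar> * (2 + \<bar>real_of_int (k $ i)\<bar>)"
    by blast
  then obtain n m :: "'d \<Rightarrow> nat"
    where diff: "\<And>i. real (m i) - real (n i) = real_of_int (k $ i)"
      and approx: "\<And>i. \<bar>l * (real (n i) + real (m i)) - x $ i\<bar> \<le> \<bar>l\<bar> * (2 + \<bar>real_of_int (k $ i)\<bar>)"
    unfolding choice_iff by blast
  define p where "p = ((\<chi> i. n i) :: nat ^ 'd, (\<chi> i. m i) :: nat ^ 'd, l)"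
  have "dist_hat (Inr (x, k)) (Inl p)
      = (\<Sum>i\<in>UNIV. \<bar>l * (real (n i) + real (m i)) - x $ i\<bar>) + \<bar>l\<bar>"
    by (simp add: p_def norm_l1_def rvec_of_nat_def rvec_of_int_def diff)
  also have "\<dots> \<le> (\<Sum>i\<in>UNIV. \<bar>l\<bar> * (2 + \<bar>real_of_int (k $ i)\<bar>)) + \<bar>l\<bar>"
    by (intro add_right_mono sum_mono approx)
  also have "\<dots> = \<delta> * C"
    unfolding C_def l(2) distrib_left[of \<delta> 1] sum_distrib_left by simp
  also have "\<dots> < e"
    by (rule \<delta>)
  finally show ?thesis
    using l(1) by (intro bexI[of _ p]) (auto simp: H_tilde_def p_def)
qed

lemma closure_of_H_tilde:
  "Metric_space.mtopology (H_hat :: ((nat ^ 'd::finite) \<times> (nat ^ 'd) \<times> real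
      + (real ^ 'd) \<times> (int ^ 'd)) set) dist_hat closure_of (Inl ` H_tilde) = H_hat"
proof -
  interpret Metric_space
    "H_hat :: ((nat ^ 'd) \<times> (nat ^ 'd) \<times> real + (real ^ 'd) \<times> (int ^ 'd)) set" dist_hat
    by (rule Metric_space_H_hat)
  have dense: "\<exists>q\<in>Inl ` H_tilde. q \<in> mball p e" if p: "p \<in> H_hat" and "0 < e" for p and e :: real
  proof (cases p)
    case (Inl p')
    with p have "p \<in> Inl ` H_tilde"
      by (auto simp: H_hat_def)
    with that show ?thesis
      by (intro bexI[of _ p]) simp_all
  next
    case (Inr xk)
    with p have "(fst xk, snd xk) \<in> H_hat0"
      by (auto simp: H_hat_def)
    from H_tilde_approximates_H_hat0[OF this \<open>0 < e\<close>] obtain q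
      where "q \<in> H_tilde" "dist_hat p (Inl q) < e"
      by (auto simp: Inr)
    moreover from this have "Inl q \<in> H_hat"
      by (auto simp: H_hat_def)
    ultimately show ?thesis
      using p by (intro bexI[of _ "Inl q"]) simp_all
  qed
  show ?thesis
    unfolding metric_closure_of
    by (intro equalityI subsetI CollectI conjI allI impI dense) simp_all
qed

section \<open>The completion\<close>

theorem proposition1p1:
  shows "is_completion (H_tilde :: ((nat ^ 'd::finite) \<times> (nat ^ 'd) \<times> real) set) dist_tilde
           Inl H_hat dist_hat"
  unfolding is_completion_def
proof (intro conjI ballI)
  show "Inl ` H_tilde \<subseteq> H_hat"
    by (auto simp: H_hat_def)
  show "dist_hat (Inl p) (Inl q) = dist_tilde p q" for p q :: "(nat ^ 'd) \<times> (nat ^ 'd) \<times> real"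
    by (simp add: dist_hat_embed dist_tilde_embed)
qed (fact Metric_space_H_tilde Metric_space_H_hat mcomplete_H_hat closure_of_H_tilde)+

end
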